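(* For every integer $k\ge2$, the formal power series $$G_k(x,p,q):=\sum_{n\ge1}x^n\sum_{w\in\mathcal F_{n,k}}p^{\mathrm{edg}(G(w))}q^{\mathrm{ver}(G(w))}$$ is equal to $$\frac{p^2q^3\left((p^2q+p^5q^3)x-(p^7q^4-p^8q^5)x^2-p^{5k}q^{3k}x^k-p^{5k+3}q^{3k+2}x^{k+1}\right)}{1-(p^3q^2+p^5q^3)x+(p^8q^5-p^9q^6)x^2+p^{5k+4}q^{3k+3}x^{k+1}}.$$
   Context: For integers $k\ge 2$, $n\ge1$, $\mathcal F_{n,k}$ is the set of binary words $w=w_1\cdots w_n$ with no $k$ consecutive $1$'s. $P(w)$ is the bargraph polyomino formed by the unit squares $[i-1,i]\times[j-1,j]$, $1\le i\le n$, $1\le j\le w_i+1$. The $k$-bonacci graph $G(w)$ is the graph whose vertices are the corners of the cells of $P(w)$ and whose edges are the cell sides (unit segments that are a side of at least one cell). $\mathrm{ver}(G)$ and $\mathrm{edg}(G)$ denote the numbers of vertices and edges of $G$. *)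

theory Defs
  imports
    "HOL-Library.Sublist"
    "HOL-Computational_Algebra.Computational_Algebra"
begin

definition kbonacci_words :: "nat \<Rightarrow> nat \<Rightarrow> nat list set" where
  "kbonacci_words n k =
     {w. length w = n \<and> set w \<subseteq> {0, 1} \<and> \<not> sublist (replicate k 1) w}"

text \<open>The cell \<open>[i - 1, i] \<times> [j - 1, j]\<close> is represented by its upper right corner \<open>(i, j)\<close>,
  where always \<open>i, j \<ge> 1\<close>, and a unit segment by the set of its two end points.
  Letters are counted from 1, so \<open>w\<^sub>i\<close> is \<open>w ! (i - 1)\<close>.\<close>

type_synonym point = "nat \<times> nat"
type_synonym cell = "nat \<times> nat"

definition bargraph :: "nat list \<Rightarrow> cell set" where
  "bargraph w = {(i, j). 1 \<le> i \<and> i \<le> length w \<and> 1 \<le> j \<and> j \<le> w ! (i - 1) + 1}"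

fun cell_corners :: "cell \<Rightarrow> point set" where
  "cell_corners (i, j) = {(i - 1, j - 1), (i, j - 1), (i - 1, j), (i, j)}"

fun cell_sides :: "cell \<Rightarrow> point set set" where
  "cell_sides (i, j) =
     {{(i - 1, j - 1), (i, j - 1)}, {(i - 1, j), (i, j)},
      {(i - 1, j - 1), (i - 1, j)}, {(i, j - 1), (i, j)}}"

definition kbonacci_graph :: "nat list \<Rightarrow> point set \<times> point set set" where
  "kbonacci_graph w =
     (\<Union>c\<in>bargraph w. cell_corners c, \<Union>c\<in>bargraph w. cell_sides c)"

definition ver :: "'v set \<times> 'v set set \<Rightarrow> nat" where
  "ver G = card (fst G)"

definition edg :: "'v set \<times> 'v set set \<Rightarrow> nat" where
  "edg G = card (snd G)"

text \<open>Power series division needs coefficients in a field, so the indeterminates \<open>p\<close>, \<open>q\<close> live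
  in the fraction field of \<open>\<int>[p][q]\<close>, and the coefficient ring \<open>\<int>[p, q]\<close> embeds into it.\<close>

type_synonym coeff_field = "int poly poly fract"

definition indet_p :: coeff_field where
  "indet_p = Fract [:[:0, 1:]:] 1"

definition indet_q :: coeff_field where
  "indet_q = Fract [:0, 1:] 1"

definition kbonacci_gf :: "nat \<Rightarrow> coeff_field fps" where
  "kbonacci_gf k = Abs_fps (\<lambda>n.
     if n \<ge> 1
     then \<Sum>w\<in>kbonacci_words n k.
            indet_p ^ edg (kbonacci_graph w) * indet_q ^ ver (kbonacci_graph w)
     else 0)"

end

theory Submission
  imports Defs
begin

text \<open>Reading a word from left to right, a letter 0 adds 3 edges and 2 vertices, a letter 1 adds 5
  edges and 3 vertices, and the first 1 of each run of 1's adds one more edge and one more vertex: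
  its upper left side is not yet present. Before the first letter there is the segment from
  \<open>(0, 0)\<close> to \<open>(0, 1)\<close>. With \<open>a = p\<^sup>3q\<^sup>2x\<close>, \<open>b = p\<^sup>5q\<^sup>3x\<close>, \<open>c = pq\<close>, the series
  \<open>Z\<close> of the words that do not end in 1 (the empty one included) and \<open>U\<close> of those that end in 1
  satisfy \<open>Z = pq\<^sup>2 + a(Z + U)\<close> and \<open>U = bU + cbZ - cb\<^sup>kZ\<close>; solving for \<open>Z + U - pq\<^sup>2\<close> gives the
  formula.\<close>

section \<open>Corners and sides added by one letter\<close>

text \<open>Adding the left frame makes the counts additive from the empty word on, and changes nothing
  for nonempty words.\<close>

definition framed_corners :: "nat list \<Rightarrow> point set" where
  "framed_corners w = {(0, 0), (0, 1)} \<union> fst (kbonacci_graph w)"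

definition framed_sides :: "nat list \<Rightarrow> point set set" where
  "framed_sides w = {{(0, 0), (0, 1)}} \<union> snd (kbonacci_graph w)"

definition ends_in_one :: "nat list \<Rightarrow> bool" where
  "ends_in_one w \<longleftrightarrow> w \<noteq> [] \<and> last w = 1"

lemma ends_in_one_Nil [simp]: "\<not> ends_in_one []"
  and ends_in_one_snoc [simp]: "ends_in_one (w @ [y]) \<longleftrightarrow> y = 1"
  by (simp_all add: ends_in_one_def)

lemma bargraph_Nil [simp]: "bargraph [] = {}"
  by (auto simp: bargraph_def)

lemma bargraph_snoc:
  "bargraph (w @ [y]) = bargraph w \<union> {Suc (length w)} \<times> {1..y + 1}"
  by (auto simp: bargraph_def nth_append le_Suc_eq split: if_splits)

lemma framed_corners_Nil [simp]: "framed_corners [] = {(0, 0), (0, 1)}"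
  and framed_sides_Nil [simp]: "framed_sides [] = {{(0, 0), (0, 1)}}"
  by (simp_all add: framed_corners_def framed_sides_def kbonacci_graph_def)

lemma framed_corners_nonempty:
  assumes "w \<noteq> []"
  shows "framed_corners w = fst (kbonacci_graph w)"
proof -
  have "(1, 1) \<in> bargraph w"
    using assms by (cases w) (auto simp: bargraph_def)
  then have "cell_corners (1, 1) \<subseteq> fst (kbonacci_graph w)"
    by (auto simp: kbonacci_graph_def simp del: cell_corners.simps)
  then show ?thesis
    by (auto simp: framed_corners_def)
qed

lemma framed_sides_nonempty:
  assumes "w \<noteq> []"
  shows "framed_sides w = snd (kbonacci_graph w)"
proof -
  have "(1, 1) \<in> bargraph w"
    using assms by (cases w) (auto simp: bargraph_def)
  then have "cell_sides (1, 1) \<subseteq> snd (kbonacci_graph w)"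
    by (auto simp: kbonacci_graph_def simp del: cell_sides.simps)
  then show ?thesis
    by (auto simp: framed_sides_def)
qed

lemma framed_corners_snoc_aux:
  "framed_corners (w @ [y]) =
     framed_corners w \<union> (\<Union>j\<in>{1..y + 1}. cell_corners (Suc (length w), j))"
  unfolding framed_corners_def kbonacci_graph_def bargraph_snoc fst_conv UN_Un Un_assoc by blast

lemma framed_sides_snoc_aux:
  "framed_sides (w @ [y]) =
     framed_sides w \<union> (\<Union>j\<in>{1..y + 1}. cell_sides (Suc (length w), j))"
  unfolding framed_sides_def kbonacci_graph_def bargraph_snoc snd_conv UN_Un Un_assoc by blast

text \<open>The lowest cell of the next column shares its left side with what is already drawn, so
  that side and its two corners are not counted again. For the empty word the frame plays the role
  of this side.\<close>

lemma right_frame_in_framed: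
  "(length w, 0) \<in> framed_corners w \<and> (length w, 1) \<in> framed_corners w
   \<and> {(length w, 0), (length w, 1)} \<in> framed_sides w"
proof (cases w rule: rev_exhaust)
  case (snoc v y)
  have "cell_corners (Suc (length v), 1) \<subseteq> framed_corners w"
    "cell_sides (Suc (length v), 1) \<subseteq> framed_sides w"
    unfolding snoc framed_corners_snoc_aux framed_sides_snoc_aux
    by (intro le_supI2 UN_upper; simp)+
  then show ?thesis
    by (simp add: snoc)
qed auto

lemma cell_heights: "{1..0 + 1} = {1::nat}" "{1..1 + 1} = {1, 2::nat}"
  by auto

text \<open>The corner \<open>(length w, 2)\<close> has to be listed for a letter 1, although it may
  be old already; \<open>upper_right_in_framed\<close> decides which.\<close>

lemma framed_corners_snoc:
  "framed_corners (w @ [0]) =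
     framed_corners w \<union> {(Suc (length w), 0), (Suc (length w), 1)}"
  "framed_corners (w @ [1]) =
     framed_corners w \<union> {(Suc (length w), 0), (Suc (length w), 1),
       (length w, 2), (Suc (length w), 2)}"
  using right_frame_in_framed[of w]
  unfolding framed_corners_snoc_aux cell_heights by auto

lemma framed_sides_snoc:
  "framed_sides (w @ [0]) =
     framed_sides w \<union> {{(length w, 0), (Suc (length w), 0)},
       {(length w, 1), (Suc (length w), 1)}, {(Suc (length w), 0), (Suc (length w), 1)}}"
  "framed_sides (w @ [1]) =
     framed_sides w \<union> {{(length w, 0), (Suc (length w), 0)},
       {(length w, 1), (Suc (length w), 1)}, {(Suc (length w), 0), (Suc (length w), 1)},
       {(length w, 1), (length w, 2)},
       {(length w, 2), (Suc (length w), 2)}, {(Suc (length w), 1), (Suc (length w), 2)}}"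
proof -
  \<comment> \<open>The sides of a cell come in the order bottom, top, left, right. The left side
    \<open>u\<close> of the lower cell is old, and its top \<open>t\<close> is also the bottom of
    the upper cell.\<close>
  have absorb: "A \<union> {s, t, u, v} = A \<union> {s, t, v}"
    "A \<union> ({s, t, u, v} \<union> {t, s', u', v'}) = A \<union> {s, t, v, u', s', v'}"
    if "u \<in> A" for A :: "point set set" and s t u v s' u' v'
    using that by blast+
  have cells: "cell_sides (Suc n, 1) = {{(n, 0), (Suc n, 0)}, {(n, 1), (Suc n, 1)},
      {(n, 0), (n, 1)}, {(Suc n, 0), (Suc n, 1)}}"
    "cell_sides (Suc n, 2) = {{(n, 1), (Suc n, 1)}, {(n, 2), (Suc n, 2)},
      {(n, 1), (n, 2)}, {(Suc n, 1), (Suc n, 2)}}" for n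
    by simp_all
  show "framed_sides (w @ [0]) =
     framed_sides w \<union> {{(length w, 0), (Suc (length w), 0)},
       {(length w, 1), (Suc (length w), 1)}, {(Suc (length w), 0), (Suc (length w), 1)}}"
    unfolding framed_sides_snoc_aux cell_heights UN_insert UN_empty Un_empty_right cells
    by (rule absorb) (use right_frame_in_framed[of w] in blast)
  show "framed_sides (w @ [1]) =
     framed_sides w \<union> {{(length w, 0), (Suc (length w), 0)},
       {(length w, 1), (Suc (length w), 1)}, {(Suc (length w), 0), (Suc (length w), 1)},
       {(length w, 1), (length w, 2)},
       {(length w, 2), (Suc (length w), 2)}, {(Suc (length w), 1), (Suc (length w), 2)}}"
    unfolding framed_sides_snoc_aux cell_heights UN_insert UN_empty Un_empty_right cells
    by (rule absorb) (use right_frame_in_framed[of w] in blast)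
qed

text \<open>The bound on abscissas makes everything that touches the right boundary of a new column
  new.\<close>

lemma framed_corners_bounded: "framed_corners w \<subseteq> {..length w} \<times> UNIV"
  by (auto simp: framed_corners_def kbonacci_graph_def bargraph_def)

lemma framed_sides_bounded: "e \<in> framed_sides w \<Longrightarrow> e \<subseteq> {..length w} \<times> UNIV"
  by (auto simp: framed_sides_def kbonacci_graph_def bargraph_def)

lemma fresh_corner: "(Suc (length w), j) \<notin> framed_corners w"
  using framed_corners_bounded[of w] by auto

lemma fresh_side:
  "{(Suc (length w), j), z} \<notin> framed_sides w" "{z, (Suc (length w), j)} \<notin> framed_sides w"
  by (auto dest: framed_sides_bounded)

text \<open>Only a last column of height two reaches the height 2 on the right boundary: a final 0
  adds nothing at that height, and the frame has height one. This is the source of the extra edge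
  and vertex at the first 1 of a run.\<close>

lemma upper_right_in_framed:
  assumes "set w \<subseteq> {0, 1}"
  shows "(length w, 2) \<in> framed_corners w \<longleftrightarrow> ends_in_one w"
    and "{(length w, 1), (length w, 2)} \<in> framed_sides w \<longleftrightarrow> ends_in_one w"
proof -
  have "((length w, 2) \<in> framed_corners w \<longleftrightarrow> ends_in_one w)
    \<and> ({(length w, 1), (length w, 2)} \<in> framed_sides w \<longleftrightarrow> ends_in_one w)"
  proof (cases w rule: rev_exhaust)
    case Nil
    then show ?thesis by (auto simp: doubleton_eq_iff)
  next
    case (snoc v y)
    then consider "y = 0" | "y = 1" using assms by auto
    then show ?thesis
    proof cases
      case 1
      then show ?thesis
        unfolding snoc by (auto simp: framed_corners_snoc framed_sides_snoc fresh_corner fresh_side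
            doubleton_eq_iff)
    next
      case 2
      then show ?thesis
        unfolding snoc by (auto simp: framed_corners_snoc[simplified] framed_sides_snoc[simplified])
    qed
  qed
  then show "(length w, 2) \<in> framed_corners w \<longleftrightarrow> ends_in_one w"
    and "{(length w, 1), (length w, 2)} \<in> framed_sides w \<longleftrightarrow> ends_in_one w"
    by blast+
qed

section \<open>Edge and vertex counts, and the weight of a word\<close>

lemma finite_bargraph: "finite (bargraph w)"
  by (induction w rule: rev_induct) (simp_all add: bargraph_snoc)

lemma finite_framed: "finite (framed_corners w)" "finite (framed_sides w)"
  using finite_bargraph[of w] by (auto simp: framed_corners_def framed_sides_def kbonacci_graph_def)

text \<open>Every listed corner lies on the new right boundary and is therefore fresh, except
  \<open>(length w, 2)\<close>, which causes the case distinction.\<close>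

lemma card_framed_corners_snoc:
  assumes "set w \<subseteq> {0, 1}"
  shows "card (framed_corners (w @ [0])) = card (framed_corners w) + 2"
    and "card (framed_corners (w @ [1])) =
      card (framed_corners w) + (if ends_in_one w then 3 else 4)"
  using upper_right_in_framed[OF assms] finite_framed[of w]
  by (simp_all add: framed_corners_snoc framed_corners_snoc[simplified] fresh_corner
      card_insert_if)

lemma card_framed_sides_snoc:
  assumes "set w \<subseteq> {0, 1}"
  shows "card (framed_sides (w @ [0])) = card (framed_sides w) + 3"
    and "card (framed_sides (w @ [1])) =
      card (framed_sides w) + (if ends_in_one w then 5 else 6)"
  using upper_right_in_framed[OF assms] finite_framed[of w]
  by (simp_all add: framed_sides_snoc framed_sides_snoc[simplified] fresh_side
      card_insert_if doubleton_eq_iff)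

definition word_weight :: "'a::comm_ring_1 \<Rightarrow> 'a \<Rightarrow> nat list \<Rightarrow> 'a" where
  "word_weight p q w = p ^ card (framed_sides w) * q ^ card (framed_corners w)"

lemma word_weight_Nil [simp]: "word_weight p q [] = p * q\<^sup>2"
  by (simp add: word_weight_def power2_eq_square)

lemma word_weight_snoc:
  assumes "set w \<subseteq> {0, 1}"
  shows "word_weight p q (w @ [0]) = p ^ 3 * q ^ 2 * word_weight p q w"
    and "word_weight p q (w @ [1]) =
      (if ends_in_one w then 1 else p * q) * (p ^ 5 * q ^ 3) * word_weight p q w"
  unfolding word_weight_def card_framed_corners_snoc[OF assms] card_framed_sides_snoc[OF assms]
  by (simp_all add: power_add algebra_simps eval_nat_numeral)

lemma ends_in_one_append_ones: "0 < m \<Longrightarrow> ends_in_one (u @ replicate m 1)"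
  by (simp add: ends_in_one_def)

text \<open>The factor \<open>p * q\<close> is paid once, by the first 1 of the run. The exponent is
  \<open>Suc m\<close> because an empty run would not pay it.\<close>

lemma word_weight_append_ones:
  assumes "set u \<subseteq> {0, 1}" "\<not> ends_in_one u"
  shows "word_weight p q (u @ replicate (Suc m) 1) =
    p * q * (p ^ 5 * q ^ 3) ^ Suc m * word_weight p q u"
proof (induction m)
  case 0
  then show ?case
    using word_weight_snoc(2)[OF assms(1)] assms(2) by simp
next
  case (Suc m)
  let ?v = "u @ replicate (Suc m) 1"
  have "set ?v \<subseteq> {0, 1}" using assms(1) by auto
  from word_weight_snoc(2)[OF this, of p q] ends_in_one_append_ones[of "Suc m" u]
  have "word_weight p q (?v @ [1]) = p ^ 5 * q ^ 3 * word_weight p q ?v" by simp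
  also have "\<dots> = p * q * (p ^ 5 * q ^ 3) ^ Suc (Suc m) * word_weight p q u"
    unfolding Suc.IH power_Suc by (simp only: mult_ac)
  also have "?v @ [1] = u @ replicate (Suc (Suc m)) 1"
    by (simp add: replicate_append_same)
  finally show ?case .
qed

section \<open>Words without k consecutive 1's, split by their last letter\<close>

lemma suffix_ones_ends_in_one:
  assumes "suffix (replicate k 1) w" "0 < k"
  shows "ends_in_one w"
  using assms ends_in_one_append_ones by (auto simp: suffix_def)

lemma finite_kbonacci_words: "finite (kbonacci_words n k)"
  by (rule finite_subset[OF _ finite_lists_length_eq[of "{0, 1}" n]])
    (auto simp: kbonacci_words_def)

lemma kbonacci_words_set: "w \<in> kbonacci_words n k \<Longrightarrow> set w \<subseteq> {0, 1}"
  by (auto simp: kbonacci_words_def)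

lemma kbonacci_words_0: "0 < k \<Longrightarrow> kbonacci_words 0 k = {[]}"
  by (auto simp: kbonacci_words_def)

text \<open>A forbidden block created by appending a letter must be a suffix, and a nonempty block
  of 1's cannot end in 0.\<close>

lemma snoc_zero_in_kbonacci_words:
  assumes "0 < k"
  shows "w @ [0] \<in> kbonacci_words (Suc n) k \<longleftrightarrow> w \<in> kbonacci_words n k"
  using suffix_ones_ends_in_one[of k "w @ [0]"] assms
  by (auto simp: kbonacci_words_def sublist_snoc del: suffix_snoc)

lemma snoc_one_in_kbonacci_words:
  "w @ [1] \<in> kbonacci_words (Suc n) k \<longleftrightarrow>
     w \<in> kbonacci_words n k \<and> \<not> suffix (replicate k 1) (w @ [1])"
  by (auto simp: kbonacci_words_def sublist_snoc del: suffix_snoc)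

text \<open>The empty word belongs here: these are the words after which a 1 opens a new
  run.\<close>

definition zero_words :: "nat \<Rightarrow> nat \<Rightarrow> nat list set" where
  "zero_words n k = {w \<in> kbonacci_words n k. \<not> ends_in_one w}"

definition one_words :: "nat \<Rightarrow> nat \<Rightarrow> nat list set" where
  "one_words n k = {w \<in> kbonacci_words n k. ends_in_one w}"

lemma zero_words_Suc:
  assumes "0 < k"
  shows "zero_words (Suc n) k = (\<lambda>w. w @ [0]) ` kbonacci_words n k"
proof (intro equalityI subsetI)
  fix w assume w: "w \<in> zero_words (Suc n) k"
  then obtain v y where "w = v @ [y]"
    by (cases w rule: rev_exhaust) (auto simp: zero_words_def kbonacci_words_def)
  moreover have "y = 0"
    using w \<open>w = v @ [y]\<close> by (auto simp: zero_words_def kbonacci_words_def)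
  ultimately show "w \<in> (\<lambda>w. w @ [0]) ` kbonacci_words n k"
    using w snoc_zero_in_kbonacci_words[OF assms] by (auto simp: zero_words_def)
qed (auto simp: zero_words_def snoc_zero_in_kbonacci_words[OF assms])

lemma one_words_Suc:
  "one_words (Suc n) k =
     (\<lambda>w. w @ [1]) ` {w \<in> kbonacci_words n k. \<not> suffix (replicate k 1) (w @ [1])}"
proof (intro equalityI subsetI)
  fix w assume w: "w \<in> one_words (Suc n) k"
  then obtain v where "w = v @ [1]"
    by (cases w rule: rev_exhaust) (auto simp: one_words_def kbonacci_words_def)
  with w show "w \<in> (\<lambda>w. w @ [1]) `
      {w \<in> kbonacci_words n k. \<not> suffix (replicate k 1) (w @ [1])}"
    using snoc_one_in_kbonacci_words[of v n k] by (auto simp: one_words_def)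
next
  fix w assume "w \<in> (\<lambda>w. w @ [1]) `
      {w \<in> kbonacci_words n k. \<not> suffix (replicate k 1) (w @ [1])}"
  then show "w \<in> one_words (Suc n) k"
    using snoc_one_in_kbonacci_words[of _ n k] by (auto simp: one_words_def)
qed

text \<open>If the appended 1's completed a block of length \<open>k\<close>, removing them would
  leave a nonempty part of the block at the end of \<open>u\<close>.\<close>

lemma append_ones_in_kbonacci_words:
  assumes "u \<in> zero_words n k" "m < k"
  shows "u @ replicate m 1 \<in> kbonacci_words (n + m) k"
  using assms(2)
proof (induction m)
  case 0
  then show ?case using assms by (simp add: zero_words_def)
next
  case (Suc m)
  let ?w = "u @ replicate (Suc m) 1"
  have "\<not> suffix (replicate k 1) ?w"
  proof
    assume "suffix (replicate k 1) ?w"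
    moreover have "replicate k 1 = replicate (k - Suc m) (1::nat) @ replicate (Suc m) 1"
      using Suc.prems by (metis le_add_diff_inverse2 less_imp_le replicate_add)
    ultimately have "suffix (replicate (k - Suc m) 1) u"
      by (simp add: suffix_def del: replicate_Suc)
    with Suc.prems have "ends_in_one u"
      by (intro suffix_ones_ends_in_one) auto
    with assms(1) show False by (simp add: zero_words_def)
  qed
  moreover have "?w = (u @ replicate m 1) @ [1]"
    by (simp add: replicate_append_same)
  ultimately show ?case
    using Suc snoc_one_in_kbonacci_words[of "u @ replicate m 1" "n + m" k] by simp
qed

text \<open>When a 1 completes a forbidden block, the final run has length exactly \<open>k\<close>,
  since a longer run would have put a block into \<open>w\<close> already. What precedes the run is
  an admissible word not ending in 1.\<close>

lemma overflowing_words: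
  assumes "0 < k"
  shows "(\<lambda>w. w @ [1]) ` {w \<in> kbonacci_words n k. suffix (replicate k 1) (w @ [1])} =
    (if Suc n < k then {} else (\<lambda>u. u @ replicate k 1) ` zero_words (Suc n - k) k)"
    (is "?L = ?R")
proof -
  obtain m where k: "k = Suc m" using assms by (cases k) auto
  have ones: "u @ replicate k 1 = (u @ replicate m 1) @ [1]" for u :: "nat list"
    by (simp add: k replicate_append_same)
  have u: "length u = Suc n - k \<and> k \<le> Suc n \<and> u \<in> zero_words (Suc n - k) k"
    if "w \<in> kbonacci_words n k" "w @ [1] = u @ replicate k 1" for w u
  proof -
    have w: "w = u @ replicate m 1" using that(2) unfolding ones by simp
    have len: "length u + m = n" using that(1) by (auto simp: w kbonacci_words_def)
    \<comment> \<open>A final 1 of \<open>u\<close> and the \<open>m = k - 1\<close> ones after it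
      would form a forbidden block inside \<open>w\<close>.\<close>
    have "\<not> ends_in_one u"
    proof
      assume "ends_in_one u"
      then obtain v where "u = v @ [1]"
        by (auto simp: ends_in_one_def) (metis append_butlast_last_id)
      then have "w = v @ replicate k 1" by (simp add: w k)
      then have "sublist (replicate k 1) w" by simp
      with that(1) show False by (simp add: kbonacci_words_def)
    qed
    moreover have "\<not> sublist (replicate k 1) u"
      using that(1) by (auto simp: w kbonacci_words_def intro: sublist_order.order.trans)
    ultimately show ?thesis
      using that(1) len by (auto simp: w k zero_words_def kbonacci_words_def)
  qed
  show ?thesis
  proof (intro equalityI subsetI)
    fix v assume "v \<in> ?L"
    then obtain w u where "w \<in> kbonacci_words n k" "v = w @ [1]" "w @ [1] = u @ replicate k 1"
      by (auto simp: suffix_def)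
    with u[of w u] show "v \<in> ?R" by auto
  next
    fix v assume "v \<in> ?R"
    then obtain u where *: "k \<le> Suc n" "u \<in> zero_words (Suc n - k) k" "v = u @ replicate k 1"
      by (auto split: if_splits)
    have "u @ replicate m 1 \<in> kbonacci_words n k"
      using append_ones_in_kbonacci_words[OF *(2), of m] *(1) by (simp add: k)
    moreover have "suffix (replicate k 1) ((u @ replicate m 1) @ [1])"
      unfolding ones[symmetric] by (simp add: suffix_def)
    ultimately show "v \<in> ?L"
      unfolding *(3) ones by blast
  qed
qed

section \<open>Generating functions and their linear system\<close>

definition weight_gf :: "'a::comm_ring_1 \<Rightarrow> 'a \<Rightarrow> (nat \<Rightarrow> nat list set) \<Rightarrow> 'a fps" where
  "weight_gf p q W = Abs_fps (\<lambda>n. \<Sum>w\<in>W n. word_weight p q w)"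

lemma weight_gf_nth [simp]: "weight_gf p q W $ n = (\<Sum>w\<in>W n. word_weight p q w)"
  by (simp add: weight_gf_def)

lemma sum_kbonacci_words_split:
  "(\<Sum>w\<in>kbonacci_words n k. f w) = (\<Sum>w\<in>zero_words n k. f w) + (\<Sum>w\<in>one_words n k. f w)"
proof -
  have "kbonacci_words n k = zero_words n k \<union> one_words n k"
    and "zero_words n k \<inter> one_words n k = {}"
    and "finite (zero_words n k)" "finite (one_words n k)"
    using finite_kbonacci_words[of n k] by (auto simp: zero_words_def one_words_def)
  then show ?thesis
    by (simp add: sum.union_disjoint)
qed

lemma kbonacci_words_gf_split:
  "weight_gf p q (\<lambda>n. kbonacci_words n k) =
     weight_gf p q (\<lambda>n. zero_words n k) + weight_gf p q (\<lambda>n. one_words n k)"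
  by (rule fps_ext) (simp add: sum_kbonacci_words_split)

text \<open>The constant is the weight of the empty word; every other word of the class is an
  arbitrary admissible word followed by 0.\<close>

lemma zero_words_gf:
  assumes "0 < k"
  shows "weight_gf p q (\<lambda>n. zero_words n k) = fps_const (p * q ^ 2)
    + fps_const (p ^ 3 * q ^ 2) * (fps_X * weight_gf p q (\<lambda>n. kbonacci_words n k))"
proof (rule fps_ext)
  fix n
  show "weight_gf p q (\<lambda>n. zero_words n k) $ n = (fps_const (p * q ^ 2)
    + fps_const (p ^ 3 * q ^ 2) * (fps_X * weight_gf p q (\<lambda>n. kbonacci_words n k))) $ n"
  proof (cases n)
    case 0
    have "zero_words 0 k = {[]}"
      by (auto simp: zero_words_def kbonacci_words_0[OF assms])
    then show ?thesis by (simp add: 0)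
  next
    case (Suc m)
    have "(\<Sum>w\<in>zero_words (Suc m) k. word_weight p q w) =
        (\<Sum>w\<in>kbonacci_words m k. word_weight p q (w @ [0]))"
      unfolding zero_words_Suc[OF assms] by (subst sum.reindex) (simp_all add: inj_on_def)
    also have "\<dots> = p ^ 3 * q ^ 2 * (\<Sum>w\<in>kbonacci_words m k. word_weight p q w)"
      unfolding sum_distrib_left
      by (rule sum.cong[OF refl]) (rule word_weight_snoc(1)[OF kbonacci_words_set])
    finally show ?thesis by (simp add: Suc)
  qed
qed

text \<open>Appending a 1 to every word of length \<open>n\<close> yields the words of length \<open>n + 1\<close> that end in 1,
  together with the words \<open>u 1\<^sup>k\<close> in which \<open>u\<close> does not end in 1.\<close>

lemma sum_one_words_Suc:
  assumes "0 < k"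
  shows "(\<Sum>w\<in>one_words (Suc n) k. word_weight p q w)
      + (if Suc n < k then 0
         else p * q * (p ^ 5 * q ^ 3) ^ k * (\<Sum>u\<in>zero_words (Suc n - k) k. word_weight p q u))
    = p ^ 5 * q ^ 3 * ((\<Sum>w\<in>one_words n k. word_weight p q w)
        + p * q * (\<Sum>w\<in>zero_words n k. word_weight p q w))"
proof -
  let ?wt = "word_weight p q"
  let ?bad = "{w \<in> kbonacci_words n k. suffix (replicate k 1) (w @ [1])}"
  let ?good = "{w \<in> kbonacci_words n k. \<not> suffix (replicate k 1) (w @ [1])}"
  have inj: "inj_on (\<lambda>w. w @ [1]) A" for A :: "nat list set"
    by (auto simp: inj_on_def)
  have over: "(\<Sum>w\<in>?bad. ?wt (w @ [1])) = (if Suc n < k then 0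
         else p * q * (p ^ 5 * q ^ 3) ^ k * (\<Sum>u\<in>zero_words (Suc n - k) k. ?wt u))"
  proof -
    have "(\<Sum>w\<in>?bad. ?wt (w @ [1])) = sum ?wt ((\<lambda>w. w @ [1]) ` ?bad)"
      by (subst sum.reindex[OF inj]) simp
    also have "\<dots> = (if Suc n < k then 0
        else (\<Sum>u\<in>zero_words (Suc n - k) k. ?wt (u @ replicate k 1)))"
      unfolding overflowing_words[OF assms] by (auto simp: sum.reindex inj_on_def)
    also have "(\<Sum>u\<in>zero_words (Suc n - k) k. ?wt (u @ replicate k 1)) =
        p * q * (p ^ 5 * q ^ 3) ^ k * (\<Sum>u\<in>zero_words (Suc n - k) k. ?wt u)"
      unfolding sum_distrib_left
    proof (rule sum.cong[OF refl])
      fix u assume "u \<in> zero_words (Suc n - k) k"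
      then have "set u \<subseteq> {0, 1}" "\<not> ends_in_one u"
        using kbonacci_words_set by (auto simp: zero_words_def)
      from word_weight_append_ones[OF this, of p q "k - 1"] assms
      show "?wt (u @ replicate k 1) = p * q * (p ^ 5 * q ^ 3) ^ k * ?wt u"
        by simp
    qed
    finally show ?thesis .
  qed
  have "(\<Sum>w\<in>one_words (Suc n) k. ?wt w) + (\<Sum>w\<in>?bad. ?wt (w @ [1]))
      = (\<Sum>w\<in>?good. ?wt (w @ [1])) + (\<Sum>w\<in>?bad. ?wt (w @ [1]))"
    unfolding one_words_Suc by (subst sum.reindex[OF inj]) simp
  also have "\<dots> = (\<Sum>w\<in>?good \<union> ?bad. ?wt (w @ [1]))"
    using finite_kbonacci_words[of n k] by (subst sum.union_disjoint) auto
  also have "?good \<union> ?bad = kbonacci_words n k"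
    by blast
  \<comment> \<open>The sum is split by the last letter of \<open>w\<close> because only a 1 that
    opens a run carries the factor \<open>p * q\<close>.\<close>
  also have "(\<Sum>w\<in>kbonacci_words n k. ?wt (w @ [1])) =
      (\<Sum>w\<in>zero_words n k. p ^ 5 * q ^ 3 * (p * q * ?wt w))
      + (\<Sum>w\<in>one_words n k. p ^ 5 * q ^ 3 * ?wt w)"
    unfolding sum_kbonacci_words_split
  proof (intro arg_cong2[of _ _ _ _ "(+)"] sum.cong refl)
    fix w assume "w \<in> zero_words n k"
    then have "set w \<subseteq> {0, 1}" "\<not> ends_in_one w"
      using kbonacci_words_set by (auto simp: zero_words_def)
    then show "?wt (w @ [1]) = p ^ 5 * q ^ 3 * (p * q * ?wt w)"
      by (subst word_weight_snoc) (simp_all add: mult_ac)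
  next
    fix w assume "w \<in> one_words n k"
    then have "set w \<subseteq> {0, 1}" "ends_in_one w"
      using kbonacci_words_set by (auto simp: one_words_def)
    then show "?wt (w @ [1]) = p ^ 5 * q ^ 3 * ?wt w"
      by (subst word_weight_snoc) simp_all
  qed
  finally show ?thesis
    unfolding over by (simp add: sum_distrib_left algebra_simps)
qed

text \<open>This collects \<open>sum_one_words_Suc\<close> over all lengths. The factor
  \<open>fps_X ^ k\<close> encodes that overflow needs length at least \<open>k\<close>; as
  \<open>0 < k\<close>, both sides vanish at length 0.\<close>

lemma one_words_gf:
  fixes p q :: "'a::comm_ring_1"
  assumes "0 < k"
  defines "Z \<equiv> weight_gf p q (\<lambda>n. zero_words n k)"
    and "U \<equiv> weight_gf p q (\<lambda>n. one_words n k)"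
  shows "U + fps_const (p * q * (p ^ 5 * q ^ 3) ^ k) * (fps_X ^ k * Z) =
    fps_const (p ^ 5 * q ^ 3) * (fps_X * (U + fps_const (p * q) * Z))"
proof (rule fps_ext)
  fix n
  show "(U + fps_const (p * q * (p ^ 5 * q ^ 3) ^ k) * (fps_X ^ k * Z)) $ n =
    (fps_const (p ^ 5 * q ^ 3) * (fps_X * (U + fps_const (p * q) * Z))) $ n"
  proof (cases n)
    case 0
    have "one_words 0 k = {}"
      by (auto simp: one_words_def kbonacci_words_0[OF assms(1)])
    then show ?thesis
      using assms(1) by (simp add: 0 U_def fps_X_power_mult_nth)
  next
    case (Suc m)
    then show ?thesis
      using sum_one_words_Suc[OF assms(1), where n = m and p = p and q = q]
      by (auto simp: U_def Z_def fps_X_power_mult_nth fps_mult_fps_X_commute)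
  qed
qed

text \<open>The series of the theorem starts at length 1, so the weight of the empty word is
  removed; at positive lengths the frame is already part of the graph.\<close>

lemma kbonacci_gf_eq:
  assumes "0 < k"
  shows "kbonacci_gf k = weight_gf indet_p indet_q (\<lambda>n. kbonacci_words n k)
    - fps_const (indet_p * indet_q ^ 2)"
proof (rule fps_ext)
  fix n
  have "word_weight indet_p indet_q w =
      indet_p ^ edg (kbonacci_graph w) * indet_q ^ ver (kbonacci_graph w)"
    if "w \<in> kbonacci_words n k" "n \<ge> 1" for w
  proof -
    have "w \<noteq> []" using that by (auto simp: kbonacci_words_def)
    then show ?thesis
      by (simp add: word_weight_def edg_def ver_def framed_corners_nonempty framed_sides_nonempty)
  qed
  then show "kbonacci_gf k $ n = (weight_gf indet_p indet_q (\<lambda>n. kbonacci_words n k)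
      - fps_const (indet_p * indet_q ^ 2)) $ n"
    by (cases n) (simp_all add: kbonacci_gf_def kbonacci_words_0[OF assms])
qed

section \<open>Solving the system for the closed form\<close>

lemma fps_eq_divideI:
  fixes f g h :: "'a::field fps"
  assumes "h $ 0 \<noteq> 0" "f * h = g"
  shows "f = g / h"
  using assms by (metis fps_nonzeroI nonzero_mult_div_cancel_right)

theorem theorem2p1:
  fixes k :: nat
  assumes "k \<ge> 2"
  shows "let p = fps_const indet_p; q = fps_const indet_q; x = fps_X in
    kbonacci_gf k =
      (p^2 * q^3 * ((p^2 * q + p^5 * q^3) * x - (p^7 * q^4 - p^8 * q^5) * x^2
          - p^(5*k) * q^(3*k) * x^k - p^(5*k + 3) * q^(3*k + 2) * x^(k + 1)))
      / (1 - (p^3 * q^2 + p^5 * q^3) * x + (p^8 * q^5 - p^9 * q^6) * x^2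
          + p^(5*k + 4) * q^(3*k + 3) * x^(k + 1))"
proof -
  have k: "0 < k" using assms by simp
  define p q x where "p = fps_const indet_p" and "q = fps_const indet_q"
    and "x = (fps_X :: coeff_field fps)"
  define T where "T = weight_gf indet_p indet_q (\<lambda>n. kbonacci_words n k)"
  define Z where "Z = weight_gf indet_p indet_q (\<lambda>n. zero_words n k)"
  define U where "U = weight_gf indet_p indet_q (\<lambda>n. one_words n k)"
  \<comment> \<open>Naming this monomial removes the symbolic exponent \<open>k\<close>, so that the
    elimination becomes a polynomial identity in \<open>p\<close>, \<open>q\<close>,
    \<open>x\<close> and \<open>B\<close>.\<close>
  define B where "B = p ^ (5 * k) * q ^ (3 * k) * x ^ k"
  note const_eqs = p_def q_def x_def fps_const_power [symmetric] fps_const_mult [symmetric]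
  have T: "T = Z + U"
    unfolding T_def Z_def U_def by (rule kbonacci_words_gf_split)
  have Z: "Z = p * q ^ 2 + p ^ 3 * q ^ 2 * (x * T)"
    using zero_words_gf[OF k, of indet_p indet_q]
    unfolding Z_def T_def const_eqs .
  have "U + p * q * (p ^ 5 * q ^ 3) ^ k * (x ^ k * Z) =
      p ^ 5 * q ^ 3 * (x * (U + p * q * Z))"
    using one_words_gf[OF k, of indet_p indet_q]
    unfolding Z_def U_def const_eqs .
  then have U: "U + p * q * B * Z = p ^ 5 * q ^ 3 * (x * (U + p * q * Z))"
    by (simp add: B_def power_mult_distrib power_mult [symmetric] mult_ac)
  have gf: "kbonacci_gf k = T - p * q ^ 2"
    unfolding kbonacci_gf_eq[OF k] T_def const_eqs ..
  \<comment> \<open>With \<open>a\<close>, \<open>b\<close>, \<open>c\<close> as in the opening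
    overview, putting \<open>U = T - Z\<close> and then \<open>Z = p * q ^ 2 + a * T\<close> into
    the equation for \<open>U\<close> leaves a linear equation for \<open>T\<close>. Its coefficient
    \<open>1 - b - a * (1 - b + c * b - c * B)\<close> is the second factor here.\<close>
  have "(T - p * q ^ 2) * (1 - (p ^ 3 * q ^ 2 + p ^ 5 * q ^ 3) * x
        + (p ^ 8 * q ^ 5 - p ^ 9 * q ^ 6) * x ^ 2 + p ^ 4 * q ^ 3 * x * B) =
      p ^ 2 * q ^ 3 * ((p ^ 2 * q + p ^ 5 * q ^ 3) * x - (p ^ 7 * q ^ 4 - p ^ 8 * q ^ 5) * x ^ 2
          - B - p ^ 3 * q ^ 2 * x * B)"
    using T Z U by algebra
  then have "kbonacci_gf k * (1 - (p^3 * q^2 + p^5 * q^3) * x + (p^8 * q^5 - p^9 * q^6) * x^2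
          + p^(5*k + 4) * q^(3*k + 3) * x^(k + 1)) =
      p^2 * q^3 * ((p^2 * q + p^5 * q^3) * x - (p^7 * q^4 - p^8 * q^5) * x^2
          - p^(5*k) * q^(3*k) * x^k - p^(5*k + 3) * q^(3*k + 2) * x^(k + 1))"
    by (simp only: gf B_def power_add power_one_right mult_ac)
  \<comment> \<open>Every term after the leading 1 has a factor \<open>x\<close>, so the constant
    coefficient is 1.\<close>
  moreover have "(1 - (p^3 * q^2 + p^5 * q^3) * x + (p^8 * q^5 - p^9 * q^6) * x^2
          + p^(5*k + 4) * q^(3*k + 3) * x^(k + 1)) $ 0 \<noteq> 0"
    by (simp add: x_def)
  ultimately show ?thesis
    unfolding Let_def p_def[symmetric] q_def[symmetric] x_def[symmetric]
    by (intro fps_eq_divideI)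
qed

end
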